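(* Let $(V_4,g)$ be a $4$-dimensional spacetime which is $W$-flat (i.e. $W_{abcd}=0$) and satisfies the Einstein field equations with a cosmological term, $R_{bc}-\frac12 R g_{bc}+\Lambda g_{bc}=k\,T_{bc}$. Let $\xi$ be a vector field and $\Omega$ a scalar function on $V_4$. Then $\xi$ is a conformal Killing vector field with $\mathcal L_\xi g_{bc}=2\Omega g_{bc}$ if and only if the energy-momentum tensor has the symmetry inheritance property $\mathcal L_\xi T_{bc}=2\Omega T_{bc}$.
   Context: A spacetime $V_4$ is a $4$-dimensional Lorentzian manifold with metric $g_{ab}$ of signature $(-,+,+,+)$ and Levi-Civita connection $\nabla$. The Riemann tensor is $R(X,Y,Z,T)=g(\nabla_X\nabla_YZ-\nabla_Y\nabla_XZ-\nabla_{[X,Y]}Z,T)$, with components $R_{abcd}$; the Ricci tensor is $R_{bc}=g^{ad}R_{abcd}$ and the scalar curvature is $R=g^{bc}R_{bc}$. The $W$-curvature tensor of $V_4$ is $W_{abcd}=R_{abcd}+\frac13\left[g_{ac}R_{bd}-g_{bc}R_{ad}\right]$. The spacetime is called $W$-flat if $W_{abcd}=0$ everywhere. $\Lambda$ is the cosmological constant, $k$ is the non-zero gravitational constant, $T_{bc}$ is the energy-momentum tensor, and $\mathcal L_\xi$ is the Lie derivative along $\xi$. A vector field $\xi$ is conformal Killing if $\mathcal L_\xi g_{bc}=2\Omega g_{bc}$ for some scalar $\Omega$; $T_{bc}$ has the symmetry inheritance property (with respect to $\xi$, $\Omega$) if $\mathcal L_\xi T_{bc}=2\Omega T_{bc}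$.
   Formalization: The "if" direction (symmetry inheritance implies conformal Killing) is proved under the added assumption that T is nonzero at every point; without it the claim fails, e.g. in Minkowski space with zero Λ and T. The "only if" direction is unrestricted. *)

theory Defs
  imports "HOL-Analysis.Analysis"
begin

section \<open>Smooth functions on open sets\<close>

fun iterated_deriv :: "'a::euclidean_space list \<Rightarrow> ('a \<Rightarrow> 'b::real_normed_vector) \<Rightarrow> 'a \<Rightarrow> 'b" where
  "iterated_deriv [] f = f"
| "iterated_deriv (v # vs) f = (\<lambda>x. frechet_derivative (iterated_deriv vs f) (at x) v)"

text \<open>On an open set \<open>S\<close> this is \<open>C\<^sup>\<infinity>\<close>: every iterated directional derivative is
  differentiable, hence continuous. It is only used for open \<open>S\<close>.\<close>

definition smooth_on :: "'a::euclidean_space set \<Rightarrow> ('a \<Rightarrow> 'b::real_normed_vector) \<Rightarrow> bool" where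
  "smooth_on S f \<longleftrightarrow> (\<forall>vs. iterated_deriv vs f differentiable_on S)"


section \<open>Four-dimensional smooth manifolds\<close>

text \<open>The points of the manifold are the elements of a Hausdorff, second countable type. A chart
  is a pair of an open set of points and a coordinate map on it (irrelevant outside that set).\<close>

type_synonym 'm chart = "'m set \<times> ('m \<Rightarrow> real^4)"

definition coords :: "'m chart \<Rightarrow> (real^4) set" where
  "coords c = snd c ` fst c"

definition point :: "'m chart \<Rightarrow> real^4 \<Rightarrow> 'm" where
  "point c = inv_into (fst c) (snd c)"

definition overlap :: "'m chart \<Rightarrow> 'm chart \<Rightarrow> (real^4) set" where
  "overlap c c' = snd c ` (fst c \<inter> fst c')"

definition transition :: "'m chart \<Rightarrow> 'm chart \<Rightarrow> real^4 \<Rightarrow> real^4" where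
  "transition c c' = snd c' \<circ> point c"

definition smooth_atlas :: "('m::{t2_space, second_countable_topology}) chart set \<Rightarrow> bool" where
  "smooth_atlas A \<longleftrightarrow>
     (\<Union>c\<in>A. fst c) = UNIV \<and>
     (\<forall>c\<in>A. open (fst c) \<and> open (coords c) \<and>
             homeomorphism (fst c) (coords c) (snd c) (point c)) \<and>
     (\<forall>c\<in>A. \<forall>c'\<in>A. smooth_on (overlap c c') (transition c c'))"


section \<open>Vector fields and covariant 2-tensor fields\<close>

text \<open>Fields are given by their coordinate expressions in the charts of the atlas, related by the
  transformation laws on overlaps. A covariant 2-tensor is a bilinear form; its components are the
  values on the coordinate vectors.\<close>

type_synonym vfield = "real^4 \<Rightarrow> real^4"
type_synonym tfield = "real^4 \<Rightarrow> real^4 \<Rightarrow> real^4 \<Rightarrow> real"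

definition vector_field :: "('m::{t2_space, second_countable_topology}) chart set \<Rightarrow>
    ('m chart \<Rightarrow> vfield) \<Rightarrow> bool" where
  "vector_field A X \<longleftrightarrow>
     (\<forall>c\<in>A. smooth_on (coords c) (X c)) \<and>
     (\<forall>c\<in>A. \<forall>c'\<in>A. \<forall>x\<in>overlap c c'.
        X c' (transition c c' x) = frechet_derivative (transition c c') (at x) (X c x))"

definition tensor_field :: "('m::{t2_space, second_countable_topology}) chart set \<Rightarrow>
    ('m chart \<Rightarrow> tfield) \<Rightarrow> bool" where
  "tensor_field A h \<longleftrightarrow>
     (\<forall>c\<in>A. (\<forall>x\<in>coords c. bilinear (h c x)) \<and>
             (\<forall>u v. smooth_on (coords c) (\<lambda>x. h c x u v))) \<and>
     (\<forall>c\<in>A. \<forall>c'\<in>A. \<forall>x\<in>overlap c c'. \<forall>u v.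
        h c x u v = h c' (transition c c' x)
                      (frechet_derivative (transition c c') (at x) u)
                      (frechet_derivative (transition c c') (at x) v))"

text \<open>Signature \<open>(-,+,+,+)\<close>, in the sense of Sylvester: there is an orthonormal frame \<open>e\<close>,
  of which the element with index \<open>0 :: 4\<close> is timelike.\<close>

definition lorentzian_metric :: "('m::{t2_space, second_countable_topology}) chart set \<Rightarrow>
    ('m chart \<Rightarrow> tfield) \<Rightarrow> bool" where
  "lorentzian_metric A g \<longleftrightarrow> tensor_field A g \<and>
     (\<forall>c\<in>A. \<forall>x\<in>coords c.
        (\<forall>u v. g c x u v = g c x v u) \<and>
        (\<exists>e :: 4 \<Rightarrow> real^4. \<forall>i j.
           g c x (e i) (e j) = (if i \<noteq> j then 0 else if i = 0 then - 1 else 1)))"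


section \<open>Connections and curvature in a chart\<close>

definition lie_bracket :: "vfield \<Rightarrow> vfield \<Rightarrow> vfield" where
  "lie_bracket X Y = (\<lambda>x. frechet_derivative Y (at x) (X x) - frechet_derivative X (at x) (Y x))"

text \<open>\<open>G x u v\<close> is the vector with components \<open>\<Gamma>\<^sup>k\<^sub>i\<^sub>j u\<^sup>i v\<^sup>j\<close>.\<close>

type_synonym conn = "real^4 \<Rightarrow> real^4 \<Rightarrow> real^4 \<Rightarrow> real^4"

definition nabla :: "conn \<Rightarrow> vfield \<Rightarrow> vfield \<Rightarrow> vfield" where
  "nabla G X Y = (\<lambda>x. frechet_derivative Y (at x) (X x) + G x (X x) (Y x))"

text \<open>Smooth, torsion-free and metric on every chart. These conditions determine the connection
  coefficients in each chart, so their transformation law on overlaps is automatic.\<close>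

definition levi_civita :: "('m::{t2_space, second_countable_topology}) chart set \<Rightarrow>
    ('m chart \<Rightarrow> tfield) \<Rightarrow> ('m chart \<Rightarrow> conn) \<Rightarrow> bool" where
  "levi_civita A g G \<longleftrightarrow> (\<forall>c\<in>A.
     (\<forall>x\<in>coords c. bilinear (G c x)) \<and>
     (\<forall>u v. smooth_on (coords c) (\<lambda>x. G c x u v)) \<and>
     (\<forall>X Y. smooth_on (coords c) X \<longrightarrow> smooth_on (coords c) Y \<longrightarrow>
        (\<forall>x\<in>coords c. nabla (G c) X Y x - nabla (G c) Y X x = lie_bracket X Y x)) \<and>
     (\<forall>X Y Z. smooth_on (coords c) X \<longrightarrow> smooth_on (coords c) Y \<longrightarrow> smooth_on (coords c) Z \<longrightarrow>
        (\<forall>x\<in>coords c.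
           frechet_derivative (\<lambda>y. g c y (Y y) (Z y)) (at x) (X x) =
             g c x (nabla (G c) X Y x) (Z x) + g c x (Y x) (nabla (G c) X Z x))))"

definition riemann :: "tfield \<Rightarrow> conn \<Rightarrow> vfield \<Rightarrow> vfield \<Rightarrow> vfield \<Rightarrow> vfield \<Rightarrow> real^4 \<Rightarrow> real" where
  "riemann g G X Y Z T = (\<lambda>x.
     g x (nabla G X (nabla G Y Z) x - nabla G Y (nabla G X Z) x - nabla G (lie_bracket X Y) Z x)
         (T x))"

definition coord_field :: "4 \<Rightarrow> vfield" where
  "coord_field a = (\<lambda>x. axis a 1)"

definition comp :: "tfield \<Rightarrow> real^4 \<Rightarrow> 4 \<Rightarrow> 4 \<Rightarrow> real" where
  "comp h x b c = h x (coord_field b x) (coord_field c x)"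

definition riemann_comp :: "tfield \<Rightarrow> conn \<Rightarrow> real^4 \<Rightarrow> 4 \<Rightarrow> 4 \<Rightarrow> 4 \<Rightarrow> 4 \<Rightarrow> real" where
  "riemann_comp g G x a b c d =
     riemann g G (coord_field a) (coord_field b) (coord_field c) (coord_field d) x"

definition inv_metric :: "tfield \<Rightarrow> real^4 \<Rightarrow> 4 \<Rightarrow> 4 \<Rightarrow> real" where
  "inv_metric g x a b = matrix_inv (\<chi> i j. comp g x i j) $ a $ b"

definition ricci :: "tfield \<Rightarrow> conn \<Rightarrow> real^4 \<Rightarrow> 4 \<Rightarrow> 4 \<Rightarrow> real" where
  "ricci g G x b c = (\<Sum>a\<in>UNIV. \<Sum>d\<in>UNIV. inv_metric g x a d * riemann_comp g G x a b c d)"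

definition scalar_curvature :: "tfield \<Rightarrow> conn \<Rightarrow> real^4 \<Rightarrow> real" where
  "scalar_curvature g G x = (\<Sum>b\<in>UNIV. \<Sum>c\<in>UNIV. inv_metric g x b c * ricci g G x b c)"

definition W_curvature :: "tfield \<Rightarrow> conn \<Rightarrow> real^4 \<Rightarrow> 4 \<Rightarrow> 4 \<Rightarrow> 4 \<Rightarrow> 4 \<Rightarrow> real" where
  "W_curvature g G x a b c d = riemann_comp g G x a b c d +
     1 / 3 * (comp g x a c * ricci g G x b d - comp g x b c * ricci g G x a d)"

definition lie_derivative :: "vfield \<Rightarrow> tfield \<Rightarrow> vfield \<Rightarrow> vfield \<Rightarrow> real^4 \<Rightarrow> real" where
  "lie_derivative \<xi> h X Y = (\<lambda>x.
     frechet_derivative (\<lambda>y. h y (X y) (Y y)) (at x) (\<xi> x)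
       - h x (lie_bracket \<xi> X x) (Y x) - h x (X x) (lie_bracket \<xi> Y x))"

definition lie_comp :: "vfield \<Rightarrow> tfield \<Rightarrow> real^4 \<Rightarrow> 4 \<Rightarrow> 4 \<Rightarrow> real" where
  "lie_comp \<xi> h x b c = lie_derivative \<xi> h (coord_field b) (coord_field c) x"


section \<open>Spacetimes\<close>

definition spacetime :: "('m::{t2_space, second_countable_topology}) chart set \<Rightarrow>
    ('m chart \<Rightarrow> tfield) \<Rightarrow> ('m chart \<Rightarrow> conn) \<Rightarrow> bool" where
  "spacetime A g G \<longleftrightarrow> smooth_atlas A \<and> lorentzian_metric A g \<and> levi_civita A g G"

definition W_flat :: "'m chart set \<Rightarrow> ('m chart \<Rightarrow> tfield) \<Rightarrow> ('m chart \<Rightarrow> conn) \<Rightarrow> bool" where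
  "W_flat A g G \<longleftrightarrow>
     (\<forall>ch\<in>A. \<forall>x\<in>coords ch. \<forall>a b c d. W_curvature (g ch) (G ch) x a b c d = 0)"

definition einstein_equations :: "'m chart set \<Rightarrow> ('m chart \<Rightarrow> tfield) \<Rightarrow> ('m chart \<Rightarrow> conn) \<Rightarrow>
    real \<Rightarrow> real \<Rightarrow> ('m chart \<Rightarrow> tfield) \<Rightarrow> bool" where
  "einstein_equations A g G \<Lambda> k T \<longleftrightarrow>
     (\<forall>ch\<in>A. \<forall>x\<in>coords ch. \<forall>b c.
        ricci (g ch) (G ch) x b c - 1 / 2 * scalar_curvature (g ch) (G ch) x * comp (g ch) x b c
          + \<Lambda> * comp (g ch) x b c = k * comp (T ch) x b c)"

text \<open>\<open>\<L>\<^sub>\<xi> h = 2 \<Omega> h\<close>, where the scalar \<open>\<Omega>\<close> is a function of the points of the manifold.\<close>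

definition lie_conformal :: "'m chart set \<Rightarrow> ('m chart \<Rightarrow> vfield) \<Rightarrow> ('m \<Rightarrow> real) \<Rightarrow>
    ('m chart \<Rightarrow> tfield) \<Rightarrow> bool" where
  "lie_conformal A \<xi> \<Omega> h \<longleftrightarrow>
     (\<forall>ch\<in>A. \<forall>x\<in>coords ch. \<forall>b c.
        lie_comp (\<xi> ch) (h ch) x b c = 2 * \<Omega> (point ch x) * comp (h ch) x b c)"

definition conformal_killing :: "'m chart set \<Rightarrow> ('m chart \<Rightarrow> tfield) \<Rightarrow> ('m chart \<Rightarrow> vfield) \<Rightarrow>
    ('m \<Rightarrow> real) \<Rightarrow> bool" where
  "conformal_killing A g \<xi> \<Omega> \<longleftrightarrow> lie_conformal A \<xi> \<Omega> g"

definition symmetry_inheritance :: "'m chart set \<Rightarrow> ('m chart \<Rightarrow> tfield) \<Rightarrow>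
    ('m chart \<Rightarrow> vfield) \<Rightarrow> ('m \<Rightarrow> real) \<Rightarrow> bool" where
  "symmetry_inheritance A T \<xi> \<Omega> \<longleftrightarrow> lie_conformal A \<xi> \<Omega> T"

text \<open>For a \<open>W\<close>-flat spacetime with the Einstein equations, \<open>k T = (\<Lambda> - R/4) g\<close> with \<open>R\<close> locally
  constant, so on each connected component \<open>T\<close> vanishes nowhere or identically.\<close>

definition nonvacuum :: "'m chart set \<Rightarrow> ('m chart \<Rightarrow> tfield) \<Rightarrow> bool" where
  "nonvacuum A T \<longleftrightarrow> (\<forall>ch\<in>A. \<forall>x\<in>coords ch. \<exists>b c. comp (T ch) x b c \<noteq> 0)"

end

theory Submission
  imports Defs
begin

text \<open>Contracting \<open>W\<^sub>a\<^sub>b\<^sub>c\<^sub>d = 0\<close> gives \<open>R\<^sub>b\<^sub>c = (R/4) g\<^sub>b\<^sub>c\<close>, hence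
  \<open>R\<^sub>a\<^sub>b\<^sub>c\<^sub>d = (R/12) (g\<^sub>b\<^sub>c g\<^sub>a\<^sub>d - g\<^sub>a\<^sub>c g\<^sub>b\<^sub>d)\<close>, and Schur's argument with the second Bianchi
  identity yields \<open>dR = 0\<close>. The field equations then say \<open>T = f g\<close> with
  \<open>f = (\<Lambda> - R/4) / k\<close> and \<open>df = 0\<close>, so \<open>\<L>\<^sub>\<xi> T = f \<L>\<^sub>\<xi> g\<close>; the factor \<open>f\<close> cancels
  where \<open>T\<close> does not vanish.\<close>

section \<open>Symmetry of second derivatives\<close>

text \<open>The mean value theorem is applied only along \<open>u\<close>, so that no continuity of the second
  derivative is needed; exchanging \<open>u\<close> and \<open>v\<close> gives the symmetry of second derivatives.\<close>

lemma second_difference_quotient: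
  fixes f :: "'a::real_normed_vector \<Rightarrow> real"
  assumes "open S" "x \<in> S"
    and f: "\<And>y. y \<in> S \<Longrightarrow> (f has_derivative f' y) (at y)"
    and L: "((\<lambda>y. f' y u) has_derivative L) (at x)"
  shows "((\<lambda>t. (f (x + t *\<^sub>R u + t *\<^sub>R v) - f (x + t *\<^sub>R u) - f (x + t *\<^sub>R v) + f x) / t\<^sup>2) \<longlongrightarrow> L v)
    (at_right 0)"
proof (rule tendstoI)
  fix e :: real assume "e > 0"
  \<comment> \<open>\<open>t * M\<close> bounds every displacement
    \<open>s *\<^sub>R u + r *\<^sub>R v\<close> with \<open>s\<close> and \<open>r\<close> between
    0 and \<open>t\<close>; the summand 1 keeps \<open>M\<close> positive when both vectors
    vanish.\<close>
  define M where "M = norm u + norm v + 1"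
  have "M > 0" unfolding M_def by (smt (verit) norm_ge_zero)
  interpret L: bounded_linear L using L by (rule has_derivative_bounded_linear)
  \<comment> \<open>The linearization is used at two points, each with error at most
    \<open>e' * (t * M)\<close>; the factor 4 makes the total \<open>t * (e / 2)\<close>, strictly
    below \<open>t * e\<close>.\<close>
  define e' where "e' = e / (4 * M)"
  have "e' > 0" using \<open>e > 0\<close> \<open>M > 0\<close> by (simp add: e'_def)
  then obtain d1 where "d1 > 0" and
    d1: "\<And>y. norm (y - x) < d1 \<Longrightarrow> norm (f' y u - f' x u - L (y - x)) \<le> e' * norm (y - x)"
    using L unfolding has_derivative_at_alt by blast
  obtain d2 where "d2 > 0" and d2: "ball x d2 \<subseteq> S"
    using assms(1,2) open_contains_ball by blast
  define d where "d = min d1 d2 / M"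
  have "d > 0" using \<open>M > 0\<close> \<open>d1 > 0\<close> \<open>d2 > 0\<close> by (simp add: d_def)
  have "dist ((f (x + t *\<^sub>R u + t *\<^sub>R v) - f (x + t *\<^sub>R u) - f (x + t *\<^sub>R v) + f x) / t\<^sup>2) (L v) < e"
    if t: "0 < t" "t < d" for t
  proof -
    have small: "norm (s *\<^sub>R u + r *\<^sub>R v) \<le> t * M \<and> norm (s *\<^sub>R u + r *\<^sub>R v) < min d1 d2"
      if "0 \<le> s" "s \<le> t" "0 \<le> r" "r \<le> t" for s r
    proof -
      have "norm (s *\<^sub>R u + r *\<^sub>R v) \<le> s * norm u + r * norm v"
        using norm_triangle_ineq[of "s *\<^sub>R u" "r *\<^sub>R v"] that by simp
      also have "\<dots> \<le> t * norm u + t * norm v"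
        by (intro add_mono mult_right_mono) (use that in auto)
      also have "\<dots> \<le> t * M" using t by (simp add: M_def algebra_simps)
      finally have 1: "norm (s *\<^sub>R u + r *\<^sub>R v) \<le> t * M" .
      have "t * M < min d1 d2" using t \<open>M > 0\<close> unfolding d_def by (simp add: pos_less_divide_eq)
      with 1 show ?thesis by linarith
    qed
    have inS: "x + s *\<^sub>R u + r *\<^sub>R v \<in> S" if "0 \<le> s" "s \<le> t" "0 \<le> r" "r \<le> t" for s r
    proof -
      have "x + s *\<^sub>R u + r *\<^sub>R v \<in> ball x d2"
        using small[OF that] by (simp add: dist_norm norm_minus_commute algebra_simps)
      then show ?thesis using d2 by blast
    qed
    \<comment> \<open>The second difference is \<open>p t - p 0\<close>, so one application of the
      mean value theorem along \<open>u\<close> suffices. The summand \<open>0 *\<^sub>R v\<close>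
      is kept so that \<open>inS\<close>, \<open>fd\<close> and \<open>err\<close> cover both
      \<open>r = t\<close> and \<open>r = 0\<close>.\<close>
    define p where "p s = f (x + s *\<^sub>R u + t *\<^sub>R v) - f (x + s *\<^sub>R u + 0 *\<^sub>R v)" for s
    have fd: "((\<lambda>s. f (x + s *\<^sub>R u + r *\<^sub>R v)) has_derivative
        (\<lambda>h. f' (x + s *\<^sub>R u + r *\<^sub>R v) (h *\<^sub>R u))) (at s within T)"
      if "0 \<le> s" "s \<le> t" "0 \<le> r" "r \<le> t" for s r T
      by (rule has_derivative_compose[where g = f])
        (auto intro!: derivative_eq_intros f inS that)
    have pd: "(p has_derivative (\<lambda>h. f' (x + s *\<^sub>R u + t *\<^sub>R v) (h *\<^sub>R u)
        - f' (x + s *\<^sub>R u + 0 *\<^sub>R v) (h *\<^sub>R u))) (at s within {0..t})" if "0 \<le> s" "s \<le> t" for s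
      unfolding p_def[abs_def] by (rule has_derivative_diff; rule fd) (use that t in auto)
    obtain s where s: "0 \<le> s" "s \<le> t" and
      "p t - p 0 = f' (x + s *\<^sub>R u + t *\<^sub>R v) ((t - 0) *\<^sub>R u) - f' (x + s *\<^sub>R u + 0 *\<^sub>R v) ((t - 0) *\<^sub>R u)"
      using mvt_very_simple[of 0 t p, OF _ pd] t by force
    moreover have "f' y (t *\<^sub>R u) = t * f' y u" if "y \<in> S" for y
      using linear_scale[OF has_derivative_linear[OF f[OF that]]] by simp
    ultimately have p: "p t - p 0 = t * (f' (x + s *\<^sub>R u + t *\<^sub>R v) u - f' (x + s *\<^sub>R u + 0 *\<^sub>R v) u)"
      using inS[of s t] inS[of s 0] t by (simp add: algebra_simps)
    have err: "\<bar>f' (x + s *\<^sub>R u + r *\<^sub>R v) u - f' x u - L (s *\<^sub>R u + r *\<^sub>R v)\<bar> \<le> e' * (t * M)"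
      if "0 \<le> r" "r \<le> t" for r
    proof -
      have "\<bar>f' (x + s *\<^sub>R u + r *\<^sub>R v) u - f' x u - L (s *\<^sub>R u + r *\<^sub>R v)\<bar> \<le> e' * norm (s *\<^sub>R u + r *\<^sub>R v)"
        using d1[of "x + s *\<^sub>R u + r *\<^sub>R v"] small[OF s that] by (simp add: algebra_simps)
      also have "\<dots> \<le> e' * (t * M)"
        using small[OF s that] \<open>e' > 0\<close> by (intro mult_left_mono) auto
      finally show ?thesis .
    qed
    \<comment> \<open>Between the estimates for \<open>r = t\<close> and \<open>r = 0\<close> the
      terms \<open>f' x u\<close> and \<open>L (s *\<^sub>R u)\<close> cancel; this leaves
      \<open>t * L v\<close> wherever the mean value point \<open>s\<close> lies.\<close>
    have "\<bar>(f' (x + s *\<^sub>R u + t *\<^sub>R v) u - f' (x + s *\<^sub>R u + 0 *\<^sub>R v) u) - t * L v\<bar> \<le> 2 * (e' * (t * M))"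
      using err[of t] err[of 0] t by (simp add: L.add L.scaleR)
    also have "\<dots> = t * (e / 2)" using \<open>M > 0\<close> by (simp add: e'_def)
    also have "\<dots> < t * e" using t \<open>e > 0\<close> by simp
    finally have "\<bar>(f' (x + s *\<^sub>R u + t *\<^sub>R v) u - f' (x + s *\<^sub>R u + 0 *\<^sub>R v) u) - t * L v\<bar> < t * e" .
    then have "\<bar>(f' (x + s *\<^sub>R u + t *\<^sub>R v) u - f' (x + s *\<^sub>R u + 0 *\<^sub>R v) u) / t - L v\<bar> < e"
      using t by (simp add: field_simps abs_if split: if_splits)
    also have "(f' (x + s *\<^sub>R u + t *\<^sub>R v) u - f' (x + s *\<^sub>R u + 0 *\<^sub>R v) u) / t = (p t - p 0) / t\<^sup>2"
      using t unfolding p by (simp add: power2_eq_square)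
    finally show ?thesis by (simp add: p_def dist_real_def algebra_simps)
  qed
  then show "\<forall>\<^sub>F t in at_right 0. dist ((f (x + t *\<^sub>R u + t *\<^sub>R v) - f (x + t *\<^sub>R u)
      - f (x + t *\<^sub>R v) + f x) / t\<^sup>2) (L v) < e"
    using \<open>d > 0\<close> unfolding eventually_at_right_field by auto
qed

lemma second_derivative_symmetric:
  fixes f :: "'a::real_normed_vector \<Rightarrow> real"
  assumes "open S" "x \<in> S"
    and "\<And>y. y \<in> S \<Longrightarrow> (f has_derivative f' y) (at y)"
    and "((\<lambda>y. f' y u) has_derivative L) (at x)"
    and "((\<lambda>y. f' y v) has_derivative M) (at x)"
  shows "L v = M u"
proof -
  have "((\<lambda>t. (f (x + t *\<^sub>R u + t *\<^sub>R v) - f (x + t *\<^sub>R u) - f (x + t *\<^sub>R v) + f x) / t\<^sup>2) \<longlongrightarrow> M u)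
      (at_right 0)"
    using second_difference_quotient[OF assms(1-3,5), where v = u] by (simp add: algebra_simps)
  with second_difference_quotient[OF assms(1-4), where v = v] show ?thesis
    using tendsto_unique trivial_limit_at_right_real by blast
qed

section \<open>Calculus of smooth maps and of fields of linear maps\<close>

abbreviation dd :: "('a::real_normed_vector \<Rightarrow> 'b::real_normed_vector) \<Rightarrow> 'a \<Rightarrow> 'a \<Rightarrow> 'b" where
  "dd f x \<equiv> frechet_derivative f (at x)"

lemma smooth_on_differentiable:
  assumes "smooth_on S F" "open S" "x \<in> S"
  shows "F differentiable (at x)" "(\<lambda>y. dd F y v) differentiable (at x)"
proof -
  have "iterated_deriv vs F differentiable (at x)" for vs
    using assms unfolding smooth_on_def differentiable_on_def by (metis at_within_open)
  from this[of "[]"] this[of "[v]"]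
  show "F differentiable (at x)" "(\<lambda>y. dd F y v) differentiable (at x)" by simp_all
qed

lemma smooth_on_const:
  fixes S :: "'a::euclidean_space set"
  shows "smooth_on S (\<lambda>y. w)"
proof -
  \<comment> \<open>The first differentiation changes the constant from \<open>w\<close> to 0, so
    the induction carries an unspecified constant.\<close>
  have "\<exists>w'. iterated_deriv vs (\<lambda>y::'a. w) = (\<lambda>y. w')" for vs
    by (induction vs) auto
  then show ?thesis
    unfolding smooth_on_def differentiable_on_def by (metis differentiable_const)
qed

text \<open>Symmetry of second derivatives is available for real-valued functions, so it is applied
  to each coordinate \<open>F y \<bullet> b\<close> separately.\<close>

lemma dd_commute:
  fixes F :: "'a::euclidean_space \<Rightarrow> 'b::euclidean_space"
  assumes "smooth_on S F" "open S" "x \<in> S"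
  shows "dd (\<lambda>y. dd F y u) x v = dd (\<lambda>y. dd F y v) x u"
proof (rule euclidean_eqI)
  fix b :: 'b assume "b \<in> Basis"
  note * = smooth_on_differentiable[OF assms(1,2), THEN frechet_derivative_works[THEN iffD1]]
  show "dd (\<lambda>y. dd F y u) x v \<bullet> b = dd (\<lambda>y. dd F y v) x u \<bullet> b"
    using second_derivative_symmetric[OF assms(2,3),
        where f = "\<lambda>y. F y \<bullet> b" and f' = "\<lambda>y h. dd F y h \<bullet> b" and u = u and v = v and
          L = "\<lambda>h. dd (\<lambda>y. dd F y u) x h \<bullet> b" and M = "\<lambda>h. dd (\<lambda>y. dd F y v) x h \<bullet> b"]
    by (simp add: has_derivative_inner_left * assms(3))
qed

text \<open>Differentiation in \<open>y\<close> preserves the linear relations that hold for all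
  \<open>y\<close> near \<open>x\<close>.\<close>

lemma linear_dd_param:
  assumes "open S" "x \<in> S" "\<And>y. y \<in> S \<Longrightarrow> linear (B y)"
    and "\<And>v. (\<lambda>y. B y v) differentiable (at x)"
  shows "linear (\<lambda>v. dd (\<lambda>y. B y v) x z)"
proof (rule linearI)
  note d = assms(4)[unfolded frechet_derivative_works]
  fix a b :: 'b and r :: real
  have "((\<lambda>y. B y (a + b)) has_derivative (\<lambda>h. dd (\<lambda>y. B y a) x h + dd (\<lambda>y. B y b) x h)) (at x)"
    by (rule has_derivative_transform_within_open[OF has_derivative_add[OF d d] assms(1,2)])
      (simp add: linear_add assms(3))
  from fun_cong[OF frechet_derivative_at[OF this], of z]
  show "dd (\<lambda>y. B y (a + b)) x z = dd (\<lambda>y. B y a) x z + dd (\<lambda>y. B y b) x z"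
    by (rule sym)
  have "((\<lambda>y. B y (r *\<^sub>R a)) has_derivative (\<lambda>h. r *\<^sub>R dd (\<lambda>y. B y a) x h)) (at x)"
    by (rule has_derivative_transform_within_open[OF has_derivative_scaleR_right[OF d] assms(1,2)])
      (simp add: linear_scale assms(3))
  from fun_cong[OF frechet_derivative_at[OF this], of z]
  show "dd (\<lambda>y. B y (r *\<^sub>R a)) x z = r *\<^sub>R dd (\<lambda>y. B y a) x z"
    by (rule sym)
qed

text \<open>A product rule for fields known to be differentiable only at fixed arguments: expanding
  \<open>F y\<close> in the basis gives a finite sum of scalar multiples, and
  \<open>linear_dd_param\<close> reassembles the differentiated sum.\<close>

lemma has_derivative_linear_apply:
  fixes B :: "'a::real_normed_vector \<Rightarrow> 'b::euclidean_space \<Rightarrow> 'c::real_normed_vector"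
  assumes "open S" "x \<in> S" "\<And>y. y \<in> S \<Longrightarrow> linear (B y)"
    and "\<And>v. (\<lambda>y. B y v) differentiable (at x)"
    and "(F has_derivative F') (at x)"
  shows "((\<lambda>y. B y (F y)) has_derivative (\<lambda>z. dd (\<lambda>y. B y (F x)) x z + B x (F' z))) (at x)"
proof -
  note d = assms(4)[unfolded frechet_derivative_works]
  have expand: "L v = (\<Sum>b\<in>Basis. (v \<bullet> b) *\<^sub>R L b)" if "linear L" for L :: "'b \<Rightarrow> 'c" and v
  proof -
    have "L v = L (\<Sum>b\<in>Basis. (v \<bullet> b) *\<^sub>R b)" by (simp add: euclidean_representation)
    also have "\<dots> = (\<Sum>b\<in>Basis. (v \<bullet> b) *\<^sub>R L b)"
      by (simp only: linear_sum[OF that] linear_scale[OF that] o_def)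
    finally show ?thesis .
  qed
  have "((\<lambda>y. \<Sum>b\<in>Basis. (F y \<bullet> b) *\<^sub>R B y b) has_derivative
      (\<lambda>z. \<Sum>b\<in>Basis. (F x \<bullet> b) *\<^sub>R dd (\<lambda>y. B y b) x z + (F' z \<bullet> b) *\<^sub>R B x b)) (at x)"
    by (intro has_derivative_sum has_derivative_scaleR has_derivative_inner_left assms(5) d)
  also have "(\<lambda>z. \<Sum>b\<in>Basis. (F x \<bullet> b) *\<^sub>R dd (\<lambda>y. B y b) x z + (F' z \<bullet> b) *\<^sub>R B x b) =
      (\<lambda>z. dd (\<lambda>y. B y (F x)) x z + B x (F' z))"
    by (simp only: sum.distrib expand[OF linear_dd_param[OF assms(1-4)], of "F x", symmetric]
        expand[OF assms(3)[OF assms(2)], symmetric])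
  finally show ?thesis
    by (rule has_derivative_transform_within_open[OF _ assms(1,2)])
      (simp add: expand[OF assms(3), symmetric])
qed

section \<open>Second Bianchi identity and Schur's lemma\<close>

text \<open>The curvature operator on constant vector fields, whose Lie brackets vanish.\<close>

definition curv :: "('a::real_normed_vector \<Rightarrow> 'a \<Rightarrow> 'a \<Rightarrow> 'a) \<Rightarrow> 'a \<Rightarrow> 'a \<Rightarrow> 'a \<Rightarrow> 'a \<Rightarrow> 'a" where
  "curv G x u v w = dd (\<lambda>y. G y v w) x u - dd (\<lambda>y. G y u w) x v + G x u (G x v w) - G x v (G x u w)"

lemma curv_has_derivative:
  fixes G :: "'a::euclidean_space \<Rightarrow> 'a \<Rightarrow> 'a \<Rightarrow> 'a"
  assumes "open S" "x \<in> S" "\<And>y. y \<in> S \<Longrightarrow> bilinear (G y)"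
    and "\<And>u v. smooth_on S (\<lambda>y. G y u v)"
  shows "((\<lambda>y. curv G y u v w) has_derivative (\<lambda>z.
    dd (\<lambda>y. dd (\<lambda>y. G y v w) y u) x z - dd (\<lambda>y. dd (\<lambda>y. G y u w) y v) x z
    + (dd (\<lambda>y. G y u (G x v w)) x z + G x u (dd (\<lambda>y. G y v w) x z))
    - (dd (\<lambda>y. G y v (G x u w)) x z + G x v (dd (\<lambda>y. G y u w) x z)))) (at x)"
proof -
  note d = smooth_on_differentiable[OF assms(4,1,2)]
  show ?thesis
    unfolding curv_def[abs_def]
    by (intro has_derivative_add has_derivative_diff has_derivative_linear_apply[OF assms(1,2)]
        frechet_derivative_works[THEN iffD1] d) (use assms(3) in \<open>auto simp: bilinear_def\<close>)
qed

text \<open>On constant fields \<open>D u v z\<close> is the commutator of \<nabla>_z with R(u,v) =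
  [\<nabla>_u, \<nabla>_v], so this is the Jacobi identity. The full covariant derivative of the
  curvature would also contain the terms R(\<nabla>_z u, v) and R(u, \<nabla>_z v).\<close>

lemma second_bianchi:
  fixes G :: "'a::euclidean_space \<Rightarrow> 'a \<Rightarrow> 'a \<Rightarrow> 'a"
  assumes "open S" "x \<in> S" "\<And>y. y \<in> S \<Longrightarrow> bilinear (G y)"
    and "\<And>u v. smooth_on S (\<lambda>y. G y u v)"
  defines "D u v z w \<equiv> dd (\<lambda>y. curv G y u v w) x z + G x z (curv G x u v w) - curv G x u v (G x z w)"
  shows "D u v z w + D v z u w + D z u v w = 0"
proof -
  have eq: "dd (\<lambda>y. curv G y u v w) x z =
    dd (\<lambda>y. dd (\<lambda>y. G y v w) y u) x z - dd (\<lambda>y. dd (\<lambda>y. G y u w) y v) x z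
    + (dd (\<lambda>y. G y u (G x v w)) x z + G x u (dd (\<lambda>y. G y v w) x z))
    - (dd (\<lambda>y. G y v (G x u w)) x z + G x v (dd (\<lambda>y. G y u w) x z))" for u v z
    by (rule fun_cong[OF frechet_derivative_at[OF curv_has_derivative[OF assms(1-4)]], symmetric])
  note bil = assms(3)[OF assms(2)]
  note c = dd_commute[OF assms(4,1,2)]
  show ?thesis
    unfolding D_def eq
    unfolding curv_def bilinear_radd[OF bil] bilinear_rsub[OF bil]
    \<comment> \<open>After the quadratic and cubic terms in \<open>G\<close> cancel, three pairs of
      mixed second derivatives remain.\<close>
    using c[of v w u z] c[of u w v z] c[of z w u v] by (simp add: algebra_simps)
qed

text \<open>The Bianchi identity leaves only terms in dK. For three distinct basis vectors
  \<open>u\<close>, \<open>v\<close>, \<open>z\<close>, the coefficient of \<open>u\<close> reads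
  dK(z) g(v,w) = dK(v) g(z,w) for all \<open>w\<close>; nondegeneracy gives dK(z) v = dK(v) z, and
  independence forces dK(z) = 0.\<close>

lemma schur:
  fixes G :: "'a::euclidean_space \<Rightarrow> 'a \<Rightarrow> 'a \<Rightarrow> 'a"
    and g :: "'a \<Rightarrow> 'a \<Rightarrow> 'a \<Rightarrow> real"
  assumes S: "open S" "x \<in> S" and dim: "3 \<le> DIM('a)"
    and G: "\<And>y. y \<in> S \<Longrightarrow> bilinear (G y)" "\<And>u v. smooth_on S (\<lambda>y. G y u v)"
    and g: "bilinear (g x)" "\<And>u v. (\<lambda>y. g y u v) differentiable (at x)"
    and nondegenerate: "\<And>u. (\<And>v. g x u v = 0) \<Longrightarrow> u = 0"
    and torsion_free: "\<And>u v. G x u v = G x v u"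
    and metric: "\<And>u v w. dd (\<lambda>y. g y v w) x u = g x (G x u v) w + g x v (G x u w)"
    and curvature: "\<And>y u v w. y \<in> S \<Longrightarrow> u \<in> Basis \<Longrightarrow> v \<in> Basis \<Longrightarrow>
      curv G y u v w = K y *\<^sub>R (g y v w *\<^sub>R u - g y u w *\<^sub>R v)"
    and K: "K differentiable (at x)"
  shows "dd K x h = 0"
proof -
  have basis: "dd K x z = 0" if z: "z \<in> Basis" for z
  proof -
    \<comment> \<open>This is where dimension at least 3 enters: two basis vectors never exhaust the
      basis.\<close>
    have pick: "\<exists>u\<in>Basis. u \<notin> F" if "card F \<le> 2" "finite F" for F :: "'a set"
      using that dim card_mono[of F Basis] by auto
    from pick[of "{z}"] obtain u where u: "u \<in> Basis" "u \<noteq> z" by auto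
    have "card {u, z} \<le> 2" by (simp add: card_insert_if)
    with pick[of "{u, z}"] obtain v where v: "v \<in> Basis" "v \<noteq> z" "v \<noteq> u" by auto
    have D: "dd (\<lambda>y. curv G y u v w) x z =
        dd K x z *\<^sub>R (g x v w *\<^sub>R u - g x u w *\<^sub>R v) +
        K x *\<^sub>R ((g x (G x z v) w + g x v (G x z w)) *\<^sub>R u - (g x (G x z u) w + g x u (G x z w)) *\<^sub>R v)"
      if "u \<in> Basis" "v \<in> Basis" for u v w z
    proof -
      have "((\<lambda>y. K y *\<^sub>R (g y v w *\<^sub>R u - g y u w *\<^sub>R v)) has_derivative
        (\<lambda>z. K x *\<^sub>R (dd (\<lambda>y. g y v w) x z *\<^sub>R u - dd (\<lambda>y. g y u w) x z *\<^sub>R v) +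
          dd K x z *\<^sub>R (g x v w *\<^sub>R u - g x u w *\<^sub>R v))) (at x)"
        by (intro has_derivative_scaleR has_derivative_diff has_derivative_scaleR_left
            frechet_derivative_works[THEN iffD1] g K)
      then have "((\<lambda>y. curv G y u v w) has_derivative
        (\<lambda>z. K x *\<^sub>R (dd (\<lambda>y. g y v w) x z *\<^sub>R u - dd (\<lambda>y. g y u w) x z *\<^sub>R v) +
          dd K x z *\<^sub>R (g x v w *\<^sub>R u - g x u w *\<^sub>R v))) (at x)"
        by (rule has_derivative_transform_within_open[OF _ S]) (simp add: curvature that)
      from fun_cong[OF frechet_derivative_at[OF this], of z, symmetric] show ?thesis
        by (simp add: metric)
    qed
    \<comment> \<open>All terms with the factor \<open>K x\<close> drop out: those containing
      \<open>G x z w\<close> and its cyclic analogues cancel against the last term of the Bianchi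
      expression, the others in pairs by symmetry of \<open>G x\<close>.\<close>
    have cyc: "dd K x z *\<^sub>R (g x v w *\<^sub>R u - g x u w *\<^sub>R v) + dd K x u *\<^sub>R (g x z w *\<^sub>R v - g x v w *\<^sub>R z)
        + dd K x v *\<^sub>R (g x u w *\<^sub>R z - g x z w *\<^sub>R u) = 0" for w
      using second_bianchi[OF S G, of u v w z]
      unfolding D[OF u(1) v(1)] D[OF v(1) z] D[OF z u(1)]
      unfolding curvature[OF S(2) u(1) v(1)] curvature[OF S(2) v(1) z] curvature[OF S(2) z u(1)]
        bilinear_rmul[OF G(1)[OF S(2)]] bilinear_rsub[OF G(1)[OF S(2)]]
        torsion_free[of u z] torsion_free[of v z] torsion_free[of v u]
      by (simp add: algebra_simps)
    have "g x (dd K x z *\<^sub>R v - dd K x v *\<^sub>R z) w = 0" for w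
    proof -
      have "dd K x z * g x v w - dd K x v * g x z w = 0"
        using arg_cong[OF cyc[of w], of "\<lambda>a. a \<bullet> u"] u v z
        by (simp add: inner_simps inner_Basis algebra_simps)
      then show ?thesis
        by (simp add: bilinear_lsub[OF g(1)] bilinear_lmul[OF g(1)])
    qed
    then have "dd K x z *\<^sub>R v - dd K x v *\<^sub>R z = 0" by (rule nondegenerate)
    from arg_cong[OF this, of "\<lambda>a. a \<bullet> v"] show ?thesis
      using v z by (simp add: inner_simps inner_Basis)
  qed
  show ?thesis
    using linear_eq_stdbasis[OF linear_frechet_derivative[OF K] linear_zero] basis by metis
qed

section \<open>Components of the metric and of the curvature\<close>

lemma comp_axis: "comp h x b c = h x (axis b 1) (axis c 1)"
  by (simp add: comp_def coord_field_def)

lemma bilinear_expand: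
  assumes "bilinear (h x)"
  shows "h x u v = (\<Sum>i\<in>UNIV. \<Sum>j\<in>UNIV. u $ i * v $ j * comp h x i j)"
proof -
  have l: "linear (\<lambda>u. h x u v)" and r: "linear (h x u)" for u v
    using assms by (auto simp: bilinear_def)
  have "h x u v = (\<Sum>i\<in>UNIV. u $ i * h x (axis i 1) v)"
    by (subst (1) basis_expansion[of u, symmetric])
      (simp add: linear_sum[OF l] linear_scale[OF l] scalar_mult_eq_scaleR)
  also have "\<dots> = (\<Sum>i\<in>UNIV. u $ i * (\<Sum>j\<in>UNIV. v $ j * comp h x i j))"
    by (subst (1) basis_expansion[of v, symmetric])
      (simp add: linear_sum[OF r] linear_scale[OF r] scalar_mult_eq_scaleR comp_axis)
  finally show ?thesis by (simp add: sum_distrib_left mult.assoc)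
qed

text \<open>With the orthonormal frame as the rows of \<open>N\<close>, the product
  \<open>N ** ?M ** transpose N\<close> is the Gram matrix diag(-1,1,1,1), whose determinant is
  nonzero.\<close>

lemma invertible_metric_matrix:
  assumes "bilinear (g x)"
    and e: "\<And>i j. g x (e i) (e j) = (if i \<noteq> j then 0 else if i = (0::4) then - 1 else 1)"
  shows "invertible (\<chi> i j. comp g x i j)" (is "invertible ?M")
proof -
  define N :: "real^4^4" where "N = (\<chi> i. e i)"
  define E :: "real^4^4" where "E = N ** ?M ** transpose N"
  have E: "E $ i $ j = (if i \<noteq> j then 0 else if i = 0 then - 1 else 1)" for i j
    unfolding e[symmetric] bilinear_expand[where h = g and x = x, OF assms(1)] E_def N_def matrix_matrix_mult_def transpose_def
    by (simp add: sum_distrib_left sum_distrib_right algebra_simps)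
      (subst sum.swap, simp)
  have "det E = (\<Prod>i\<in>UNIV. E $ i $ i)"
    by (rule det_diagonal) (simp add: E)
  also have "\<dots> \<noteq> 0" by (simp add: E)
  finally have "det ?M \<noteq> 0" unfolding E_def det_mul by auto
  then show ?thesis by (simp add: invertible_det_nz)
qed

lemma metric_nondegenerate:
  assumes "bilinear (g x)" "\<And>u v. g x u v = g x v u" "invertible (\<chi> i j. comp g x i j)"
    and u: "\<And>d. g x u (axis d 1) = 0"
  shows "u = 0"
proof -
  have "(\<chi> i j. comp g x i j) *v u = 0"
  proof (rule vec_eq_iff[THEN iffD2], rule allI)
    fix d
    have "g x (axis d 1) u = (\<Sum>i\<in>UNIV. \<Sum>j\<in>UNIV. axis d 1 $ i * u $ j * comp g x i j)"
      by (rule bilinear_expand[where h = g and x = x, OF assms(1)])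
    also have "\<dots> = (\<Sum>i\<in>UNIV. if i = d then \<Sum>j\<in>UNIV. u $ j * comp g x i j else 0)"
      by (intro sum.cong) (auto simp: axis_def)
    finally show "((\<chi> i j. comp g x i j) *v u) $ d = 0 $ d"
      using u[of d] assms(2)[of u] by (simp add: matrix_vector_mult_def mult.commute)
  qed
  then show ?thesis
    using assms(3) matrix_left_invertible_ker[of "\<chi> i j. comp g x i j"] unfolding invertible_def by blast
qed

text \<open>Coordinate fields are constant, so their derivatives and brackets vanish and only the
  connection coefficients contribute.\<close>

lemma riemann_comp_curv:
  assumes "bilinear (G x)"
  shows "riemann_comp g G x a b c d = g x (curv G x (axis a 1) (axis b 1) (axis c 1)) (axis d 1)"
proof -
  have n: "nabla G (coord_field b) (coord_field c) = (\<lambda>y. G y (axis b 1) (axis c 1))" for b c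
    by (simp add: nabla_def coord_field_def)
  have l: "lie_bracket (coord_field a) (coord_field b) = (\<lambda>y. 0)" for a b
    by (simp add: lie_bracket_def coord_field_def)
  show ?thesis
    unfolding riemann_comp_def riemann_def n l
    by (simp add: nabla_def coord_field_def bilinear_lzero[OF assms] curv_def algebra_simps)
qed

section \<open>Pointwise algebra of W-flatness\<close>

context
  fixes g :: tfield and G :: conn and x :: "real^4"
  assumes sym: "\<And>u v. g x u v = g x v u" and inv: "invertible (\<chi> i j. comp g x i j)"
    and flat: "\<And>a b c d. W_curvature g G x a b c d = 0"
begin

text \<open>Contracting with \<open>inv_metric g x a d\<close> turns the first W-term into R times
  the metric and, through a Kronecker delta, the second into the Ricci tensor itself: R_bc = (R g_bc
  - R_bc)/3.\<close>

lemma W_flat_ricci: "ricci g G x b c = scalar_curvature g G x / 4 * comp g x b c"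
proof -
  let ?M = "\<chi> i j. comp g x i j"
  have inv: "(\<Sum>a\<in>UNIV. inv_metric g x a d * comp g x a c) = (if c = d then 1 else 0)" for c d
  proof -
    have "(?M ** matrix_inv ?M) $ c $ d = (\<Sum>a\<in>UNIV. inv_metric g x a d * comp g x a c)"
      by (simp add: matrix_matrix_mult_def inv_metric_def comp_axis sym[of "axis c 1"] mult.commute)
    \<comment> \<open>\<open>matrix_inv\<close> is a Hilbert choice, so its defining property rests
      on the existence of an inverse.\<close>
    moreover have "?M ** matrix_inv ?M = mat 1"
      using inv unfolding invertible_def matrix_inv_def by (metis (mono_tags, lifting) someI_ex)
    ultimately show ?thesis by (simp add: mat_def)
  qed
  have W: "riemann_comp g G x a b c d =
      1/3 * (comp g x b c * ricci g G x a d - comp g x a c * ricci g G x b d)" for a b c d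
    using flat[of a b c d] unfolding W_curvature_def by (simp add: algebra_simps)
  have "ricci g G x b c = (\<Sum>a\<in>UNIV. \<Sum>d\<in>UNIV. inv_metric g x a d *
      (1/3 * (comp g x b c * ricci g G x a d - comp g x a c * ricci g G x b d)))"
    by (subst ricci_def) (simp only: W)
  also have "\<dots> = 1/3 * (comp g x b c * scalar_curvature g G x) -
      1/3 * (\<Sum>a\<in>UNIV. \<Sum>d\<in>UNIV. inv_metric g x a d * comp g x a c * ricci g G x b d)"
    unfolding scalar_curvature_def
    by (simp add: sum_distrib_left sum_subtractf[symmetric] algebra_simps)
  also have "(\<Sum>a\<in>UNIV. \<Sum>d\<in>UNIV. inv_metric g x a d * comp g x a c * ricci g G x b d) =
      (\<Sum>d\<in>UNIV. (if c = d then 1 else 0) * ricci g G x b d)"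
    by (subst sum.swap) (simp add: inv sum_distrib_right[symmetric])
  also have "\<dots> = ricci g G x b c" by (simp add: if_distrib[of "\<lambda>z. z * _"] cong: if_cong)
  finally have "4 * ricci g G x b c = comp g x b c * scalar_curvature g G x" by linarith
  then show ?thesis by (simp add: field_simps)
qed

text \<open>The factor is 1/3 from W times 1/4 from the Ricci tensor. Nondegeneracy lifts the
  component identity to vectors, and linearity extends it to arbitrary \<open>w\<close>, as Schur's
  argument evaluates the curvature at vectors such as \<open>G x z w\<close>.\<close>

lemma W_flat_curv:
  assumes G: "bilinear (G x)" "linear (curv G x (axis a 1) (axis b 1))" and g: "bilinear (g x)"
  shows "curv G x (axis a 1) (axis b 1) w =
    (scalar_curvature g G x / 12) *\<^sub>R (g x (axis b 1) w *\<^sub>R axis a 1 - g x (axis a 1) w *\<^sub>R axis b 1)"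
    (is "?l w = ?r w")
proof -
  have r: "linear (g x u)" for u using g by (simp add: bilinear_def)
  have "?l (axis c 1) = ?r (axis c 1)" for c
  proof -
    have "?l (axis c 1) - ?r (axis c 1) = 0"
    proof (rule metric_nondegenerate[OF g sym inv])
      fix d
      have "g x (?l (axis c 1)) (axis d 1) = riemann_comp g G x a b c d"
        by (simp add: riemann_comp_curv[where G=G, OF G(1)])
      also have "\<dots> = scalar_curvature g G x / 12 *
          (comp g x b c * comp g x a d - comp g x a c * comp g x b d)"
        using flat[of a b c d] unfolding W_curvature_def W_flat_ricci by (simp add: algebra_simps)
      finally show "g x (?l (axis c 1) - ?r (axis c 1)) (axis d 1) = 0"
        by (simp add: bilinear_lsub[OF g] bilinear_lmul[OF g] comp_axis)
    qed
    then show ?thesis by simp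
  qed
  moreover have "linear ?r"
    by (intro linearI) (simp_all add: linear_add[OF r] linear_scale[OF r] algebra_simps)
  ultimately show ?thesis
    using linear_eq_stdbasis[OF G(2) \<open>linear ?r\<close>] by (auto simp: Basis_vec_def fun_eq_iff)
qed

end

section \<open>Consequences of the spacetime axioms in one chart\<close>

lemma levi_civita_torsion_free:
  assumes "levi_civita A g G" "c \<in> A" "x \<in> coords c"
  shows "G c x u v = G c x v u"
proof -
  have "nabla (G c) (\<lambda>_. u) (\<lambda>_. v) x - nabla (G c) (\<lambda>_. v) (\<lambda>_. u) x =
      lie_bracket (\<lambda>_. u) (\<lambda>_. v) x"
    using assms smooth_on_const unfolding levi_civita_def by blast
  then show ?thesis by (simp add: nabla_def lie_bracket_def)
qed

lemma levi_civita_metric: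
  assumes "levi_civita A g G" "c \<in> A" "x \<in> coords c"
  shows "dd (\<lambda>y. g c y v w) x u = g c x (G c x u v) w + g c x v (G c x u w)"
proof -
  have "dd (\<lambda>y. g c y ((\<lambda>_. v) y) ((\<lambda>_. w) y)) x ((\<lambda>_. u) x) =
      g c x (nabla (G c) (\<lambda>_. u) (\<lambda>_. v) x) w + g c x v (nabla (G c) (\<lambda>_. u) (\<lambda>_. w) x)"
    using assms smooth_on_const unfolding levi_civita_def by blast
  then show ?thesis by (simp add: nabla_def)
qed

lemma linear_curv:
  assumes "open S" "x \<in> S" "\<And>y. y \<in> S \<Longrightarrow> bilinear (G y)"
    and "\<And>u v. smooth_on S (\<lambda>y. G y u v)"
  shows "linear (curv G x u v)"
proof -
  have "linear (G y u)" if "y \<in> S" for y u using assms(3)[OF that] by (simp add: bilinear_def)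
  note l = linear_dd_param[OF assms(1,2) this smooth_on_differentiable(1)[OF assms(4,1,2)]]
  note bil = assms(3)[OF assms(2)]
  show ?thesis
    by (intro linearI) (simp_all add: curv_def linear_add[OF l] linear_scale[OF l]
        bilinear_radd[OF bil] bilinear_rmul[OF bil] algebra_simps)
qed

lemma spacetime_chart:
  assumes "spacetime A g G" "ch \<in> A"
  shows "open (coords ch)"
    and "x \<in> coords ch \<Longrightarrow> bilinear (G ch x)"
    and "smooth_on (coords ch) (\<lambda>x. G ch x u v)"
    and "x \<in> coords ch \<Longrightarrow> bilinear (g ch x)"
    and "smooth_on (coords ch) (\<lambda>x. g ch x u v)"
    and "x \<in> coords ch \<Longrightarrow> g ch x u v = g ch x v u"
    and "x \<in> coords ch \<Longrightarrow> invertible (\<chi> i j. comp (g ch) x i j)"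
proof -
  show "open (coords ch)"
    using assms unfolding spacetime_def smooth_atlas_def by blast
  show "x \<in> coords ch \<Longrightarrow> bilinear (G ch x)" "smooth_on (coords ch) (\<lambda>x. G ch x u v)"
    using assms unfolding spacetime_def levi_civita_def by blast+
  show g: "x \<in> coords ch \<Longrightarrow> bilinear (g ch x)" "smooth_on (coords ch) (\<lambda>x. g ch x u v)"
    using assms unfolding spacetime_def lorentzian_metric_def tensor_field_def by blast+
  show "x \<in> coords ch \<Longrightarrow> g ch x u v = g ch x v u"
    using assms unfolding spacetime_def lorentzian_metric_def by blast
  assume x: "x \<in> coords ch"
  then obtain e :: "4 \<Rightarrow> real^4"
    where "\<And>i j. g ch x (e i) (e j) = (if i \<noteq> j then 0 else if i = 0 then - 1 else 1)"
    using assms unfolding spacetime_def lorentzian_metric_def by meson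
  then show "invertible (\<chi> i j. comp (g ch) x i j)"
    using invertible_metric_matrix[where g = "g ch", OF g(1)[OF x]] by blast
qed

section \<open>Field equations and local constancy of the scalar curvature\<close>

text \<open>The coefficient is R/4 - R/2 + \<Lambda> divided by \<open>k\<close>; bilinearity passes
  from components to all vectors.\<close>

lemma einstein_W_flat:
  assumes "spacetime A g G" "W_flat A g G" "tensor_field A T" "k \<noteq> 0"
    and "einstein_equations A g G \<Lambda> k T" "ch \<in> A" "x \<in> coords ch"
  shows "T ch x u v = (\<Lambda> - scalar_curvature (g ch) (G ch) x / 4) / k * g ch x u v"
proof -
  note sp = spacetime_chart[OF assms(1,6)]
  have flat: "W_curvature (g ch) (G ch) x a b c d = 0" for a b c d
    using assms(2,6,7) unfolding W_flat_def by blast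
  have T: "bilinear (T ch x)" using assms(3,6,7) unfolding tensor_field_def by blast
  let ?f = "(\<Lambda> - scalar_curvature (g ch) (G ch) x / 4) / k"
  have "comp (T ch) x b c = ?f * comp (g ch) x b c" for b c
  proof -
    have "ricci (g ch) (G ch) x b c - 1 / 2 * scalar_curvature (g ch) (G ch) x * comp (g ch) x b c
        + \<Lambda> * comp (g ch) x b c = k * comp (T ch) x b c"
      using assms(5-7) unfolding einstein_equations_def by blast
    moreover have "ricci (g ch) (G ch) x b c = scalar_curvature (g ch) (G ch) x / 4 * comp (g ch) x b c"
      by (rule W_flat_ricci[where g = "g ch" and G = "G ch"]) (use sp(6,7) assms(7) flat in auto)
    ultimately show ?thesis using \<open>k \<noteq> 0\<close> by (simp add: field_simps)
  qed
  then show ?thesis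
    unfolding bilinear_expand[where h = "T ch" and x = x, OF T]
      bilinear_expand[where h = "g ch" and x = x, OF sp(4)[OF assms(7)]]
    by (simp add: sum_distrib_left algebra_simps)
qed

text \<open>Schur's lemma is applied with \<open>K\<close> equal to R/12. A vanishing derivative at
  each point is all that the Lie derivative needs.\<close>

lemma scalar_curvature_stationary:
  assumes "spacetime A g G" "W_flat A g G" "tensor_field A T" "k \<noteq> 0"
    and "einstein_equations A g G \<Lambda> k T" "ch \<in> A" "x \<in> coords ch"
  shows "(scalar_curvature (g ch) (G ch) has_derivative (\<lambda>_. 0)) (at x)"
proof -
  note sp = spacetime_chart[OF assms(1,6)]
  let ?S = "coords ch" and ?R = "scalar_curvature (g ch) (G ch)"
  have flat: "W_curvature (g ch) (G ch) y a b c d = 0" if "y \<in> ?S" for y a b c d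
    using assms(2,6) that unfolding W_flat_def by blast
  have lc: "levi_civita A g G" using assms(1) unfolding spacetime_def by blast
  have dg: "(\<lambda>y. g ch y u v) differentiable (at y)" if "y \<in> ?S" for u v y
    by (rule smooth_on_differentiable(1)[OF sp(5,1) that])
  have "smooth_on ?S (\<lambda>y. T ch y u v)" for u v
    using assms(3,6) unfolding tensor_field_def by blast
  note dT = smooth_on_differentiable(1)[OF this sp(1) assms(7)]
  have nondeg: "u = 0" if "\<And>v. g ch x u v = 0" for u
    using metric_nondegenerate[where g = "g ch" and x = x,
        OF sp(4)[OF assms(7)] sp(6)[OF assms(7)] sp(7)[OF assms(7)]] that by blast
  \<comment> \<open>Nondegeneracy at one nonzero vector supplies a nonvanishing denominator at
    \<open>x\<close>.\<close>
  obtain u v where uv: "g ch x u v \<noteq> 0"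
    using nondeg[of "axis 0 1"] by (metis axis_eq_0_iff one_neq_zero)
  \<comment> \<open>\<open>R\<close> is differentiable because the field equations express it through a quotient \<open>T u v / g u v\<close>.\<close>
  have "continuous_on ?S (\<lambda>y. g ch y u v)"
    using dg by (intro differentiable_imp_continuous_on) (simp add: differentiable_on_def differentiable_at_withinI)
  \<comment> \<open>The denominator stays nonzero on this open set, so the quotient formula for R
    holds near \<open>x\<close> and its derivative transfers to R.\<close>
  then have U: "open (?S \<inter> (\<lambda>y. g ch y u v) -` (- {0}))"
    by (rule continuous_open_preimage[OF _ sp(1)]) auto
  have "(\<lambda>y. 4 * (\<Lambda> - k * (T ch y u v / g ch y u v))) differentiable (at x)"
    using dT dg[OF assms(7)] uv by (intro derivative_intros) auto
  then have "((\<lambda>y. 4 * (\<Lambda> - k * (T ch y u v / g ch y u v))) has_derivative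
      dd (\<lambda>y. 4 * (\<Lambda> - k * (T ch y u v / g ch y u v))) x) (at x)"
    by (rule frechet_derivative_works[THEN iffD1])
  then have "(?R has_derivative
      dd (\<lambda>y. 4 * (\<Lambda> - k * (T ch y u v / g ch y u v))) x) (at x)"
    by (rule has_derivative_transform_within_open[OF _ U])
      (use assms(4,7) uv einstein_W_flat[OF assms(1-6)] in auto)
  then have R: "?R differentiable (at x)" by (rule differentiableI)
  have "((\<lambda>y. ?R y / 12) has_derivative (\<lambda>h. dd ?R x h / 12)) (at x)"
    using R by (auto intro!: derivative_eq_intros simp: frechet_derivative_works)
  note R' = this frechet_derivative_at[OF this]
  have "dd (\<lambda>y. ?R y / 12) x h = 0" for h
  proof (rule schur[OF sp(1) assms(7), where G = "G ch" and g = "g ch" and K = "\<lambda>y. ?R y / 12"])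
    fix y u v w :: "real^4" assume y: "y \<in> ?S" and "u \<in> Basis" "v \<in> Basis"
    then obtain a b where ab: "u = axis a 1" "v = axis b 1" by (auto simp: Basis_vec_def)
    show "curv (G ch) y u v w = (?R y / 12) *\<^sub>R (g ch y v w *\<^sub>R u - g ch y u w *\<^sub>R v)"
      unfolding ab
      by (rule W_flat_curv[where g = "g ch" and G = "G ch"])
        (use sp flat y linear_curv[OF sp(1) y, of "G ch"] in auto)
  qed (use sp dg nondeg assms(6,7) levi_civita_torsion_free[OF lc] levi_civita_metric[OF lc] R'
      in \<open>auto intro: differentiableI\<close>)
  then have "dd ?R x = (\<lambda>_. 0)" unfolding R'(2)[symmetric] by auto
  with R show ?thesis by (simp add: frechet_derivative_works)
qed

section \<open>Lie derivatives of proportional tensors and the equivalence\<close>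

text \<open>The Leibniz rule would add X(f) times \<open>g\<close>, which vanishes since the
  derivative of \<open>f\<close> at \<open>x\<close> is zero; the bracket terms depend only on the
  value of the tensor at \<open>x\<close> and scale by \<open>f x\<close>.\<close>

lemma lie_comp_multiple:
  assumes "open S" "x \<in> S" "(f has_derivative (\<lambda>_. 0)) (at x)"
    and "\<And>u v. (\<lambda>y. g y u v) differentiable (at x)"
    and T: "\<And>y u v. y \<in> S \<Longrightarrow> T y u v = f y * g y u v"
  shows "lie_comp X T x b c = f x * lie_comp X g x b c"
proof -
  have "dd (\<lambda>y. T y u v) x h = f x * dd (\<lambda>y. g y u v) x h" for u v h
  proof -
    have "((\<lambda>y. f y * g y u v) has_derivative (\<lambda>h. f x * dd (\<lambda>y. g y u v) x h + 0 * g x u v)) (at x)"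
      by (intro has_derivative_mult assms(3) assms(4)[unfolded frechet_derivative_works])
    then have "((\<lambda>y. T y u v) has_derivative (\<lambda>h. f x * dd (\<lambda>y. g y u v) x h + 0 * g x u v)) (at x)"
      by (rule has_derivative_transform_within_open[OF _ assms(1,2)]) (simp add: T)
    from fun_cong[OF frechet_derivative_at[OF this], of h] show ?thesis by simp
  qed
  then show ?thesis
    by (simp add: lie_comp_def lie_derivative_def coord_field_def T[OF assms(2)] algebra_simps)
qed

theorem theorem3p3:
  fixes A :: "('m::{t2_space, second_countable_topology}) chart set"
    and g T :: "'m chart \<Rightarrow> tfield"
    and G :: "'m chart \<Rightarrow> conn"
    and \<xi> :: "'m chart \<Rightarrow> vfield"
    and \<Omega> :: "'m \<Rightarrow> real"
    and \<Lambda> k :: real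
  assumes "spacetime A g G"
    and "W_flat A g G"
    and "tensor_field A T"
    and "k \<noteq> 0"
    and "einstein_equations A g G \<Lambda> k T"
    and "vector_field A \<xi>"
  shows "(conformal_killing A g \<xi> \<Omega> \<longrightarrow> symmetry_inheritance A T \<xi> \<Omega>) \<and>
         (nonvacuum A T \<longrightarrow> symmetry_inheritance A T \<xi> \<Omega> \<longrightarrow> conformal_killing A g \<xi> \<Omega>)"
proof -
  define f where "f ch x = (\<Lambda> - scalar_curvature (g ch) (G ch) x / 4) / k" for ch x
  have T: "T ch x u v = f ch x * g ch x u v" if "ch \<in> A" "x \<in> coords ch" for ch x u v
    unfolding f_def by (rule einstein_W_flat[OF assms(1-5) that])
  have L: "lie_comp (\<xi> ch) (T ch) x b c = f ch x * lie_comp (\<xi> ch) (g ch) x b c"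
    if "ch \<in> A" "x \<in> coords ch" for ch x b c
  proof (rule lie_comp_multiple[OF _ that(2)])
    note sp = spacetime_chart[OF assms(1) that(1)]
    show "open (coords ch)" by (rule sp(1))
    show "(f ch has_derivative (\<lambda>_. 0)) (at x)"
      unfolding f_def using scalar_curvature_stationary[OF assms(1-5) that] \<open>k \<noteq> 0\<close>
      by (auto intro!: derivative_eq_intros)
    show "(\<lambda>y. g ch y u v) differentiable (at x)" for u v
      by (rule smooth_on_differentiable(1)[OF sp(5,1) that(2)])
  qed (rule T[OF that(1)])
  have Tc: "comp (T ch) x b c = f ch x * comp (g ch) x b c"
    if "ch \<in> A" "x \<in> coords ch" for ch x b c
    by (simp add: comp_def T that)
  \<comment> \<open>Some component of \<open>T\<close> is nonzero at \<open>x\<close> and equals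
    \<open>f ch x\<close> times a component of \<open>g\<close>.\<close>
  have "f ch x \<noteq> 0" if "nonvacuum A T" "ch \<in> A" "x \<in> coords ch" for ch x
    using that Tc unfolding nonvacuum_def by fastforce
  then show ?thesis
    unfolding conformal_killing_def symmetry_inheritance_def lie_conformal_def
    by (simp add: L Tc)
qed

end
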